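(* Let $G=(V,E)$ be a transitively reduced DAG with $n=|V|$ and $m=|E|$, and let $\ell=|E(\mathrm{TC}(G))|$. There exists a one-sided error monotonicity $\varepsilon$-tester for functions $f:V\to\mathbb{R}$ on $G$ with query complexity \[ O\!\left(\frac{\sqrt{m\,\ell}}{\varepsilon n}\right). \]
   Context: The transitive closure $\mathrm{TC}(G)$ has edge set $\{(u,v): u\leadsto v\}$ where $u\leadsto v$ means there is a directed path from $u$ to $v$ in $G$. $G$ is transitively reduced if it is the minimal DAG with the same transitive closure. A function $f:V\to\mathbb{R}$ is monotone if $f(u)\le f(v)$ whenever $u\leadsto v$. Let $d_{\mathrm{mon}}(f)$ be the minimum number of vertices at which $f$ must be changed to obtain a monotone function; $f$ is $\varepsilon$-far if $d_{\mathrm{mon}}(f)>\varepsilon n$. A one-sided error $\varepsilon$-tester, given $G$ explicitly and oracle access to $f$, always accepts monotone $f$ and rejects $\varepsilon$-far $f$ with probability at least $2/3$. Only oracle queries to $f$ are counted; all computation on $G$ (including computing $\mathrm{TC}(G)$ and sampling uniformly from $E$ or $E(\mathrm{TC}(G))$) is free. *)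

theory Defs
  imports "HOL-Probability.Probability"
begin

text \<open>The strict transitive closure \<open>E\<^sup>+\<close> is the edge set of \<open>TC(G)\<close>: since \<open>G\<close> is acyclic,
  it contains no loops, so length-zero paths are not counted as edges.\<close>

definition dag :: "'v set \<Rightarrow> ('v \<times> 'v) set \<Rightarrow> bool" where
  "dag V E \<longleftrightarrow> finite V \<and> E \<subseteq> V \<times> V \<and> acyclic E"

definition transitively_reduced :: "'v set \<Rightarrow> ('v \<times> 'v) set \<Rightarrow> bool" where
  "transitively_reduced V E \<longleftrightarrow>
     dag V E \<and> (\<forall>E'. dag V E' \<and> E'\<^sup>+ = E\<^sup>+ \<longrightarrow> \<not> E' \<subset> E)"

definition graph_monotone :: "'v set \<Rightarrow> ('v \<times> 'v) set \<Rightarrow> ('v \<Rightarrow> real) \<Rightarrow> bool" where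
  "graph_monotone V E f \<longleftrightarrow> monotone_on V (\<lambda>u v. (u, v) \<in> E\<^sup>+) (\<le>) f"

text \<open>The infimum below is a minimum: the set of values is a nonempty set of natural numbers,
  because constant functions are monotone.\<close>

definition d_mon :: "'v set \<Rightarrow> ('v \<times> 'v) set \<Rightarrow> ('v \<Rightarrow> real) \<Rightarrow> nat" where
  "d_mon V E f = (INF g\<in>{g. graph_monotone V E g}. card {v \<in> V. f v \<noteq> g v})"

definition far_from_monotone :: "'v set \<Rightarrow> ('v \<times> 'v) set \<Rightarrow> real \<Rightarrow> ('v \<Rightarrow> real) \<Rightarrow> bool" where
  "far_from_monotone V E \<epsilon> f \<longleftrightarrow> real (d_mon V E f) > \<epsilon> * real (card V)"

text \<open>A deterministic adaptive query algorithm is a decision tree that branches on the real value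
  returned by the oracle; its leaves carry the verdict (\<open>True\<close> for acceptance). A randomized
  algorithm is a probability distribution over such trees. The graph and \<open>\<epsilon>\<close> are known, so a tree
  may depend on them arbitrarily, and only oracle queries have a cost.\<close>

datatype 'v query_tree = Verdict bool | Query 'v "real \<Rightarrow> 'v query_tree"

primrec accepts :: "'v query_tree \<Rightarrow> ('v \<Rightarrow> real) \<Rightarrow> bool" where
  "accepts (Verdict b) f = b"
| "accepts (Query v k) f = accepts (k (f v)) f"

primrec queries :: "'v query_tree \<Rightarrow> ('v \<Rightarrow> real) \<Rightarrow> 'v list" where
  "queries (Verdict b) f = []"
| "queries (Query v k) f = v # queries (k (f v)) f"

text \<open>The functions under test live on \<open>V\<close> only, so a tester must not query other elements of the
  ambient type.\<close>

definition one_sided_monotonicity_tester ::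
    "'v set \<Rightarrow> ('v \<times> 'v) set \<Rightarrow> real \<Rightarrow> 'v query_tree pmf \<Rightarrow> bool" where
  "one_sided_monotonicity_tester V E \<epsilon> T \<longleftrightarrow>
     (\<forall>t\<in>set_pmf T. \<forall>f. set (queries t f) \<subseteq> V) \<and>
     (\<forall>f. graph_monotone V E f \<longrightarrow> measure_pmf.prob T {t. accepts t f} = 1) \<and>
     (\<forall>f. far_from_monotone V E \<epsilon> f \<longrightarrow> measure_pmf.prob T {t. \<not> accepts t f} \<ge> 2 / 3)"

text \<open>Worst case over the randomness and over all inputs; repeated queries are counted.\<close>

definition query_complexity_le :: "'v query_tree pmf \<Rightarrow> real \<Rightarrow> bool" where
  "query_complexity_le T q \<longleftrightarrow> (\<forall>t\<in>set_pmf T. \<forall>f. real (length (queries t f)) \<le> q)"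

end

theory Submission imports Defs begin

text \<open>Let \<open>f\<close> be far from monotone, let \<open>a\<close> be the number of violated edges of \<open>E\<close> and \<open>b\<close> the number
  of violated pairs of \<open>E\<^sup>+\<close>. A maximal set \<open>M\<close> of violated pairs with distinct first and distinct
  second coordinates has size at least \<open>\<epsilon> n / 2\<close>, since its coordinates cover all violations.
  Every pair of \<open>M\<close> is joined by a path through a violated edge. If \<open>k\<close> pairs \<open>(u\<^sub>i, v\<^sub>i)\<close> choose
  the same edge, then all \<open>(u\<^sub>i, v\<^sub>j)\<close> lie in \<open>E\<^sup>+\<close>, and one of \<open>(u\<^sub>i, v\<^sub>j)\<close>, \<open>(u\<^sub>j, v\<^sub>i)\<close> is
  violated, which gives at least \<open>k\<^sup>2 / 2\<close> violated pairs. By Cauchy-Schwarz \<open>|M|\<^sup>2 \<le> 2 a b\<close>. A pair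
  drawn with probability one half each from \<open>E\<close> and from \<open>E\<^sup>+\<close> is thus violated with probability
  \<open>(a / m + b / \<ell>) / 2 \<ge> sqrt (a b / (m \<ell>)) = \<Omega>(\<epsilon> n / sqrt (m \<ell>))\<close>.\<close>

section \<open>Violated edges, violated pairs and matchings of them\<close>

definition violations :: "('v \<Rightarrow> real) \<Rightarrow> ('v \<times> 'v) set \<Rightarrow> ('v \<times> 'v) set" where
  "violations f R = {p \<in> R. f (snd p) < f (fst p)}"

lemma violations_subset: "violations f R \<subseteq> R"
  by (auto simp: violations_def)

lemma graph_monotone_iff_violations:
  assumes "E \<subseteq> V \<times> V"
  shows "graph_monotone V E f \<longleftrightarrow> violations f (E\<^sup>+) = {}"
  using trancl_subset_Sigma[OF assms]
  by (auto simp: graph_monotone_def monotone_on_def violations_def not_less)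

text \<open>Follow the path from \<open>u\<close> with \<open>f u\<close> held fixed. If the value
  before the last edge is already below \<open>f u\<close>, the shorter path contains a violated
  edge; otherwise the last edge itself descends.\<close>

lemma trancl_violation_edge:
  fixes f :: "'v \<Rightarrow> real"
  assumes "(u, v) \<in> E\<^sup>+" "f v < f u"
  shows "\<exists>x y. (x, y) \<in> violations f E \<and> (u, x) \<in> E\<^sup>* \<and> (y, v) \<in> E\<^sup>*"
  using assms
proof (induction rule: trancl_induct)
  case (base y)
  then show ?case by (auto simp: violations_def)
next
  case (step y z)
  show ?case
  proof (cases "f y < f u")
    case True
    then show ?thesis using step by (meson rtrancl.rtrancl_into_rtrancl)
  next
    case False
    then have "(y, z) \<in> violations f E" using step by (auto simp: violations_def)
    then show ?thesis using step.hyps by (meson trancl_into_rtrancl rtrancl.rtrancl_refl)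
  qed
qed

text \<open>Cauchy-Schwarz over the fibres of \<open>h\<close>: \<open>card M\<close> is the sum of
  the fibre sizes, and the kernel of \<open>h\<close> on \<open>M\<close> has as cardinality the sum
  of their squares.\<close>

lemma card_squared_le_image_times_kernel:
  assumes "finite M"
  shows "(card M)\<^sup>2 \<le> card (h ` M) * card {(p, q) \<in> M \<times> M. h p = h q}"
proof -
  define K where "K e = {p \<in> M. h p = e}" for e
  have M: "card M = (\<Sum>e\<in>h ` M. card (K e))"
    unfolding K_def using sum.image_gen[OF assms, of "\<lambda>_. 1::nat" h] by simp
  have "{(p, q) \<in> M \<times> M. h p = h q} = (\<Union>e\<in>h ` M. K e \<times> K e)"
    by (auto simp: K_def)
  also have "card \<dots> = (\<Sum>e\<in>h ` M. card (K e \<times> K e))"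
    using assms by (intro card_UN_disjoint) (auto simp: K_def)
  finally have S: "card {(p, q) \<in> M \<times> M. h p = h q} = (\<Sum>e\<in>h ` M. (card (K e))\<^sup>2)"
    by (simp add: card_cartesian_product power2_eq_square)
  have "(\<Sum>e\<in>h ` M. real (card (K e)))\<^sup>2 \<le> real (card (h ` M)) * (\<Sum>e\<in>h ` M. (real (card (K e)))\<^sup>2)"
    using sum_squared_le_sum_of_squares[of "\<lambda>e. real (card (K e))" "h ` M"] assms
    by (simp add: mult.commute)
  then have "real ((card M)\<^sup>2) \<le> real (card (h ` M) * card {(p, q) \<in> M \<times> M. h p = h q})"
    unfolding S M by simp
  then show ?thesis by (simp only: of_nat_le_iff)
qed

lemma matching_squared_le_violations:
  fixes f :: "'v \<Rightarrow> real"
  assumes fin: "finite E" and M: "M \<subseteq> violations f (E\<^sup>+)" and inj: "inj_on fst M" "inj_on snd M"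
  shows "(card M)\<^sup>2 \<le> 2 * (card (violations f E) * card (violations f (E\<^sup>+)))"
proof -
  have finV: "finite (violations f E)" "finite (violations f (E\<^sup>+))"
    using fin by (auto intro: finite_subset[OF violations_subset])
  have finM: "finite M" using M finV(2) by (rule finite_subset)
  have "\<forall>p\<in>M. \<exists>e\<in>violations f E. (fst p, fst e) \<in> E\<^sup>* \<and> (snd e, snd p) \<in> E\<^sup>*"
  proof
    fix p assume "p \<in> M"
    then have "(fst p, snd p) \<in> E\<^sup>+" "f (snd p) < f (fst p)"
      using M by (auto simp: violations_def)
    from trancl_violation_edge[OF this]
    show "\<exists>e\<in>violations f E. (fst p, fst e) \<in> E\<^sup>* \<and> (snd e, snd p) \<in> E\<^sup>*"
      by (metis fst_conv snd_conv)
  qed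
  then obtain h where h: "\<And>p. p \<in> M \<Longrightarrow> h p \<in> violations f E"
    "\<And>p. p \<in> M \<Longrightarrow> (fst p, fst (h p)) \<in> E\<^sup>*" "\<And>p. p \<in> M \<Longrightarrow> (snd (h p), snd p) \<in> E\<^sup>*"
    by metis
  \<comment> \<open>\<open>S\<close> holds the ordered pairs of matching pairs that chose the same
    edge, the diagonal included. \<open>B\<close> keeps those whose crossed pair
    \<open>(fst p, snd q)\<close> is violated.\<close>
  define S where "S = {(p, q) \<in> M \<times> M. h p = h q}"
  define B where "B = {(p, q) \<in> S. f (snd q) < f (fst p)}"
  have finB: "finite B"
    by (rule finite_subset[of _ "M \<times> M"]) (auto simp: B_def S_def finM)
  have "S \<subseteq> B \<union> prod.swap ` B"
  proof
    fix x assume x: "x \<in> S"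
    obtain p q where pq: "x = (p, q)" by (cases x)
    have "f (snd p) < f (fst p)" "f (snd q) < f (fst q)"
      using x M pq by (auto simp: S_def violations_def)
    \<comment> \<open>Adding the two inequalities shows that the crossed pairs cannot both be
      unviolated, so \<open>B\<close> and its mirror image cover \<open>S\<close>.\<close>
    then have "f (snd q) < f (fst p) \<or> f (snd p) < f (fst q)" by linarith
    then have "(p, q) \<in> B \<or> (q, p) \<in> B" using x pq by (auto simp: B_def S_def)
    then show "x \<in> B \<union> prod.swap ` B" using pq by force
  qed
  then have "card S \<le> card (B \<union> prod.swap ` B)" using finB by (intro card_mono) auto
  also have "\<dots> \<le> card B + card (prod.swap ` B)" by (rule card_Un_le)
  also have "\<dots> \<le> 2 * card B" using card_image_le[OF finB, of prod.swap] by simp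
  finally have S_le: "card S \<le> 2 * card B" .
  have B_le: "card B \<le> card (violations f (E\<^sup>+))"
  proof (rule card_inj_on_le[where f = "\<lambda>(p, q). (fst p, snd q)"])
    \<comment> \<open>The first coordinate determines \<open>p\<close> and the second determines
      \<open>q\<close>; this is why both projections of \<open>M\<close> must be injective.\<close>
    show "inj_on (\<lambda>(p, q). (fst p, snd q)) B"
      using inj by (auto simp: inj_on_def B_def S_def)
    have "(fst p, snd q) \<in> E\<^sup>+" if "p \<in> M" "q \<in> M" "h p = h q" for p q
    proof -
      have "(fst (h p), snd (h p)) \<in> E" using h(1)[OF that(1)] by (simp add: violations_def)
      then show ?thesis using h(2)[OF that(1)] h(3)[OF that(2)] that(3)
        by (metis rtrancl_into_trancl1 trancl_rtrancl_trancl)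
    qed
    then show "(\<lambda>(p, q). (fst p, snd q)) ` B \<subseteq> violations f (E\<^sup>+)"
      by (force simp: B_def S_def violations_def)
  qed (rule finV)
  have "(card M)\<^sup>2 \<le> card (h ` M) * card S"
    unfolding S_def by (rule card_squared_le_image_times_kernel[OF finM])
  also have "\<dots> \<le> card (violations f E) * (2 * card (violations f (E\<^sup>+)))"
    using S_le B_le h(1) finV by (intro mult_mono card_mono) auto
  finally show ?thesis by simp
qed

section \<open>Distance to monotonicity and vertex covers of the violated pairs\<close>

lemma d_mon_le_cover:
  assumes fin: "finite V" and E: "E \<subseteq> V \<times> V" and W: "W \<subseteq> V"
    and cover: "\<And>u v. (u, v) \<in> violations f (E\<^sup>+) \<Longrightarrow> u \<in> W \<or> v \<in> W"
  shows "d_mon V E f \<le> card W"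
proof -
  \<comment> \<open>Repair of \<open>f\<close> on \<open>W\<close>: \<open>g v\<close> is the
    largest value of \<open>f\<close> at vertices outside \<open>W\<close> that reach
    \<open>v\<close>. The default \<open>c\<close> keeps the set nonempty and lies below every value
    on \<open>V\<close>, so it never raises \<open>g\<close> above \<open>f\<close>; the inserted 0
    makes \<open>Min\<close> meaningful for empty \<open>V\<close>.\<close>
  define c where "c = Min (insert 0 (f ` V))"
  define A where "A v = insert c (f ` {u \<in> V - W. (u, v) \<in> E\<^sup>*})" for v
  define g where "g v = Max (A v)" for v
  have finA: "finite (A v)" for v using fin by (simp add: A_def)
  have "g u \<le> g v" if "(u, v) \<in> E\<^sup>+" for u v
    unfolding g_def
  proof (rule Max_mono)
    show "A u \<subseteq> A v" using that by (auto simp: A_def dest: trancl_into_rtrancl)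
  qed (use finA in \<open>auto simp: A_def\<close>)
  then have mono: "graph_monotone V E g" by (auto simp: graph_monotone_def monotone_on_def)
  have eq: "g v = f v" if v: "v \<in> V - W" for v
    unfolding g_def
  proof (rule Max_eqI)
    fix y assume "y \<in> A v"
    then consider "y = c" | u where "u \<in> V - W" "(u, v) \<in> E\<^sup>*" "y = f u" by (auto simp: A_def)
    then show "y \<le> f v"
    proof cases
      case 1
      then show ?thesis using v fin by (auto simp: c_def)
    next
      case 2
      then have "(u, v) \<notin> violations f (E\<^sup>+)" using cover v by blast
      then show ?thesis using 2 by (auto simp: violations_def rtrancl_eq_or_trancl not_less)
    qed
  qed (use v finA in \<open>auto simp: A_def\<close>)
  have "{v \<in> V. f v \<noteq> g v} \<subseteq> W"
  proof
    fix v assume "v \<in> {v \<in> V. f v \<noteq> g v}"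
    then show "v \<in> W" using eq[of v] by auto
  qed
  then have "card {v \<in> V. f v \<noteq> g v} \<le> card W"
    using finite_subset[OF W fin] by (intro card_mono)
  moreover have "d_mon V E f \<le> card {v \<in> V. f v \<noteq> g v}"
    unfolding d_mon_def using mono by (intro cINF_lower) auto
  ultimately show ?thesis by simp
qed

lemma exists_violation_matching:
  assumes fin: "finite V" and E: "E \<subseteq> V \<times> V"
  shows "\<exists>M \<subseteq> violations f (E\<^sup>+). inj_on fst M \<and> inj_on snd M \<and> d_mon V E f \<le> 2 * card M"
proof -
  define N where "N = {M. M \<subseteq> violations f (E\<^sup>+) \<and> inj_on fst M \<and> inj_on snd M}"
  have sub: "violations f (E\<^sup>+) \<subseteq> V \<times> V"
    using violations_subset[of f "E\<^sup>+"] trancl_subset_Sigma[OF E] by blast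
  have finV: "finite (violations f (E\<^sup>+))" using finite_subset[OF sub] fin by simp
  have "finite N"
    by (rule finite_subset[of _ "Pow (violations f (E\<^sup>+))"]) (use finV in \<open>auto simp: N_def\<close>)
  moreover have "N \<noteq> {}" unfolding N_def by (rule ex_in_conv[THEN iffD1], rule exI[of _ "{}"]) simp
  ultimately obtain M where M: "M \<in> N" and max: "\<forall>M'\<in>N. M \<subseteq> M' \<longrightarrow> M = M'"
    using finite_has_maximal[of N] by metis
  have M': "M \<subseteq> violations f (E\<^sup>+)" "inj_on fst M" "inj_on snd M" using M by (simp_all add: N_def)
  have finM: "finite M" using finite_subset[OF M'(1) finV] .
  \<comment> \<open>The endpoints of a maximal \<open>M\<close> form a vertex cover: if neither
    \<open>u\<close> nor \<open>v\<close> is an endpoint, adding \<open>(u, v)\<close> keeps both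
    projections injective.\<close>
  have "u \<in> fst ` M \<union> snd ` M \<or> v \<in> fst ` M \<union> snd ` M" if uv: "(u, v) \<in> violations f (E\<^sup>+)" for u v
  proof (rule ccontr)
    assume n: "\<not> ?thesis"
    then have "insert (u, v) M \<in> N" using M' uv by (simp add: N_def inj_on_insert) blast
    then have "M = insert (u, v) M" using max subset_insertI by metis
    then have "(u, v) \<in> M" by (metis insertI1)
    then have "u \<in> fst ` M" by (rule image_eqI[rotated]) simp
    then show False using n by simp
  qed
  moreover have "fst ` M \<union> snd ` M \<subseteq> V" using subset_trans[OF M'(1) sub] by auto
  ultimately have "d_mon V E f \<le> card (fst ` M \<union> snd ` M)"
    by (intro d_mon_le_cover[OF fin E]) auto
  also have "\<dots> \<le> card (fst ` M) + card (snd ` M)" by (rule card_Un_le)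
  also have "\<dots> \<le> 2 * card M" using card_image_le[OF finM, of fst] card_image_le[OF finM, of snd] by simp
  finally show ?thesis using M' by (intro exI[of _ M]) simp
qed

lemma d_mon_squared_le_violations:
  assumes "finite V" "E \<subseteq> V \<times> V"
  shows "(d_mon V E f)\<^sup>2 \<le> 8 * (card (violations f E) * card (violations f (E\<^sup>+)))"
proof -
  obtain M where M: "M \<subseteq> violations f (E\<^sup>+)" "inj_on fst M" "inj_on snd M"
    and d: "d_mon V E f \<le> 2 * card M"
    using exists_violation_matching[OF assms] by blast
  have "finite E" using finite_subset[OF assms(2)] assms(1) by simp
  \<comment> \<open>The constant is 8 = 4 * 2: \<open>d_mon\<close> is at most twice
    \<open>card M\<close>, and the matching bound carries a factor 2.\<close>
  have "(d_mon V E f)\<^sup>2 \<le> 4 * (card M)\<^sup>2" using power_mono[OF d, of 2] by (simp add: power_mult_distrib)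
  also have "(card M)\<^sup>2 \<le> 2 * (card (violations f E) * card (violations f (E\<^sup>+)))"
    using matching_squared_le_violations[OF \<open>finite E\<close> M] .
  finally show ?thesis by simp
qed

section \<open>Query trees for sampled pairs, and the probability of their acceptance\<close>

primrec pair_test :: "('v \<times> 'v) list \<Rightarrow> 'v query_tree" where
  "pair_test [] = Verdict True"
| "pair_test (p # ps) =
     Query (fst p) (\<lambda>a. Query (snd p) (\<lambda>b. if b < a then Verdict False else pair_test ps))"

lemma accepts_pair_test: "accepts (pair_test ps) f \<longleftrightarrow> (\<forall>p\<in>set ps. f (fst p) \<le> f (snd p))"
  by (induction ps) (simp_all add: not_le[symmetric])

lemma set_queries_pair_test: "set (queries (pair_test ps) f) \<subseteq> Field (set ps)"
proof (induction ps)
  case (Cons p ps)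
  then show ?case by (cases p) (auto simp: Field_def)
qed simp

lemma length_queries_pair_test: "length (queries (pair_test ps) f) \<le> 2 * length ps"
  by (induction ps) auto

lemma prob_replicate_pmf_all:
  "measure_pmf.prob (replicate_pmf r Q) {xs. \<forall>x\<in>set xs. P x} = measure_pmf.prob Q {x. P x} ^ r"
proof (induction r)
  case (Suc r)
  let ?R = "replicate_pmf r Q" and ?all = "{xs. \<forall>x\<in>set xs. P x}"
  \<comment> \<open>Conditioning on the first sample \<open>x\<close>: prepending \<open>x\<close>
    pulls the event back to the same event on the tail if \<open>P x\<close> holds, and to the empty
    set otherwise.\<close>
  have step: "emeasure (bind_pmf ?R (\<lambda>xs. return_pmf (x # xs))) ?all = emeasure ?R ?all * indicator {x. P x} x" for x
  proof -
    have "(#) x -` ?all = (if P x then ?all else {})" by auto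
    then show ?thesis by (simp add: map_pmf_def[symmetric])
  qed
  have "emeasure (replicate_pmf (Suc r) Q) ?all = emeasure ?R ?all * emeasure Q {x. P x}"
    unfolding replicate_pmf.simps emeasure_bind_pmf[of Q] step by (simp add: nn_integral_cmult)
  then have "ennreal (measure_pmf.prob (replicate_pmf (Suc r) Q) ?all)
      = ennreal (measure_pmf.prob ?R ?all * measure_pmf.prob Q {x. P x})"
    by (simp only: measure_pmf.emeasure_eq_measure ennreal_mult measure_nonneg)
  then show ?case using Suc by (subst (asm) ennreal_inj) auto
qed simp

definition mix_pmf :: "'a pmf \<Rightarrow> 'a pmf \<Rightarrow> 'a pmf" where
  "mix_pmf P Q = bernoulli_pmf (1 / 2) \<bind> (\<lambda>b. if b then P else Q)"

lemma prob_mix_pmf: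
  "measure_pmf.prob (mix_pmf P Q) A = (measure_pmf.prob P A + measure_pmf.prob Q A) / 2"
proof -
  have "ennreal (measure_pmf.prob (mix_pmf P Q) A)
      = ennreal (1 / 2) * ennreal (measure_pmf.prob P A) + ennreal (1 / 2) * ennreal (measure_pmf.prob Q A)"
    unfolding measure_pmf.emeasure_eq_measure[symmetric] mix_pmf_def emeasure_bind_pmf
    by (subst nn_integral_bernoulli_pmf) (auto simp: mult.commute)
  also have "\<dots> = ennreal ((measure_pmf.prob P A + measure_pmf.prob Q A) / 2)"
    by (subst (1 2) ennreal_mult[symmetric], simp_all only: measure_nonneg)
      (simp_all add: ennreal_plus[symmetric] add_divide_distrib del: ennreal_plus)
  finally show ?thesis by (subst (asm) ennreal_inj) auto
qed

text \<open>All \<open>r\<close> pairs are drawn independently before any query, so the distribution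
  on trees is the image of a distribution on lists.\<close>

definition edge_tester :: "('v \<times> 'v) set \<Rightarrow> nat \<Rightarrow> 'v query_tree pmf" where
  "edge_tester E r = map_pmf pair_test (replicate_pmf r (mix_pmf (pmf_of_set E) (pmf_of_set (E\<^sup>+))))"

lemma set_pmf_edge_tester:
  assumes "finite E" "E \<noteq> {}" and t: "t \<in> set_pmf (edge_tester E r)"
  obtains ps where "t = pair_test ps" "set ps \<subseteq> E\<^sup>+" "length ps = r"
proof -
  have "E\<^sup>+ \<noteq> {}" "finite (E\<^sup>+)" using assms by auto
  note [simp] = set_pmf_of_set[OF assms(2,1)] set_pmf_of_set[OF this]
  have "set_pmf (mix_pmf (pmf_of_set E) (pmf_of_set (E\<^sup>+))) \<subseteq> E\<^sup>+"
    by (auto simp: mix_pmf_def split: if_splits)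
  then show thesis
    using t that by (auto simp: edge_tester_def set_replicate_pmf lists_eq_set)
qed

lemma prob_edge_tester_rejects:
  "measure_pmf.prob (edge_tester E r) {t. \<not> accepts t f} =
    1 - (1 - measure_pmf.prob (mix_pmf (pmf_of_set E) (pmf_of_set (E\<^sup>+))) {p. f (snd p) < f (fst p)}) ^ r"
proof -
  let ?Q = "mix_pmf (pmf_of_set E) (pmf_of_set (E\<^sup>+))"
  have "measure_pmf.prob (edge_tester E r) {t. accepts t f}
      = measure_pmf.prob (replicate_pmf r ?Q) {ps. \<forall>p\<in>set ps. \<not> f (snd p) < f (fst p)}"
    by (simp add: edge_tester_def vimage_def accepts_pair_test not_less)
  also have "\<dots> = measure_pmf.prob ?Q {p. \<not> f (snd p) < f (fst p)} ^ r"
    by (rule prob_replicate_pmf_all)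
  finally show ?thesis
    using measure_pmf.prob_neg[of ?Q "\<lambda>p. f (snd p) < f (fst p)"]
      measure_pmf.prob_neg[of "edge_tester E r" "\<lambda>t. accepts t f"]
    by simp
qed

section \<open>Rejection probability and correctness of the tester\<close>

lemma prob_sampled_violation_ge:
  assumes fin: "finite V" and E: "E \<subseteq> V \<times> V" "E \<noteq> {}"
  shows "measure_pmf.prob (mix_pmf (pmf_of_set E) (pmf_of_set (E\<^sup>+))) {p. f (snd p) < f (fst p)}
    \<ge> real (d_mon V E f) / (3 * sqrt (real (card E) * real (card (E\<^sup>+))))"
proof -
  have finE: "finite E" using finite_subset[OF E(1)] fin by simp
  have E': "finite (E\<^sup>+)" "E\<^sup>+ \<noteq> {}" using finE E by auto
  define a where "a = real (card (violations f E))"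
  define b where "b = real (card (violations f (E\<^sup>+)))"
  have prob: "measure_pmf.prob (pmf_of_set R) {p. f (snd p) < f (fst p)} = real (card (violations f R)) / real (card R)"
    if "finite R" "R \<noteq> {}" for R
  proof -
    have "violations f R = R \<inter> {p. f (snd p) < f (fst p)}" by (auto simp: violations_def)
    then show ?thesis using that by (simp add: measure_pmf_of_set)
  qed
  have "real ((d_mon V E f)\<^sup>2) \<le> real (8 * (card (violations f E) * card (violations f (E\<^sup>+))))"
    using d_mon_squared_le_violations[OF fin E(1), of f] by (simp only: of_nat_le_iff)
  then have "(real (d_mon V E f))\<^sup>2 \<le> 8 * (a * b)" by (simp add: a_def b_def)
  moreover have "0 \<le> a * b" by (simp add: a_def b_def)
  \<comment> \<open>The constant 8 is weakened to 9, which turns the square root into the integer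
    3.\<close>
  ultimately have "(real (d_mon V E f) / 3)\<^sup>2 \<le> a * b" by (simp add: power_divide)
  then have "real (d_mon V E f) / 3 \<le> sqrt (a * b)" by (rule real_le_rsqrt)
  then have "real (d_mon V E f) / 3 / sqrt (real (card E) * real (card (E\<^sup>+)))
      \<le> sqrt (a * b) / sqrt (real (card E) * real (card (E\<^sup>+)))"
    by (rule divide_right_mono) simp
  also have "\<dots> = sqrt ((a / real (card E)) * (b / real (card (E\<^sup>+))))"
    by (simp only: times_divide_times_eq real_sqrt_divide)
  also have "\<dots> \<le> (a / real (card E) + b / real (card (E\<^sup>+))) / 2"
    by (rule arith_geo_mean_sqrt) (auto simp: a_def b_def)
  also have "\<dots> = measure_pmf.prob (mix_pmf (pmf_of_set E) (pmf_of_set (E\<^sup>+))) {p. f (snd p) < f (fst p)}"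
    using prob finE E(2) E' by (simp add: prob_mix_pmf a_def b_def)
  finally show ?thesis by simp
qed

text \<open>From \<open>1 - p \<le> exp (- p)\<close> the power is at most \<open>exp (- 2)\<close>,
  and \<open>exp 2 \<ge> 1 + 2\<close> suffices for one third.\<close>

lemma one_minus_power_le_third:
  fixes p :: real
  assumes "0 \<le> p" "p \<le> 1" "2 \<le> p * real r"
  shows "(1 - p) ^ r \<le> 1 / 3"
proof -
  have "(1 - p) ^ r \<le> exp (- p) ^ r"
    using assms exp_ge_add_one_self[of "- p"] by (intro power_mono) auto
  also have "\<dots> = exp (- (p * real r))" by (simp add: exp_of_nat_mult[symmetric] mult.commute)
  also have "\<dots> \<le> exp (- 2)" using assms by simp
  also have "\<dots> \<le> 1 / 3" using exp_ge_add_one_self[of "2::real"] by (simp add: exp_minus field_simps)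
  finally show ?thesis .
qed

lemma edge_tester_one_sided:
  assumes fin: "finite V" and E: "E \<subseteq> V \<times> V" "E \<noteq> {}" and \<epsilon>: "\<epsilon> > 0" and V: "card V > 0"
    and r: "6 * sqrt (real (card E) * real (card (E\<^sup>+))) / (\<epsilon> * real (card V)) \<le> real r"
  shows "one_sided_monotonicity_tester V E \<epsilon> (edge_tester E r)"
proof -
  have finE: "finite E" using finite_subset[OF E(1)] fin by simp
  have sub: "E\<^sup>+ \<subseteq> V \<times> V" using trancl_subset_Sigma[OF E(1)] .
  have "set (queries t f) \<subseteq> V" if t: "t \<in> set_pmf (edge_tester E r)" for t f
  proof -
    obtain ps where "t = pair_test ps" "set ps \<subseteq> E\<^sup>+"
      using set_pmf_edge_tester[OF finE E(2) t] by metis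
    then show ?thesis using set_queries_pair_test[of ps f] sub by (auto simp: Field_def)
  qed
  moreover have "measure_pmf.prob (edge_tester E r) {t. accepts t f} = 1"
    if "graph_monotone V E f" for f
  proof (subst measure_pmf.prob_eq_1)
    \<comment> \<open>Every pair in the support lies in \<open>E\<^sup>+\<close>, and a monotone
      \<open>f\<close> violates none of these.\<close>
    have "accepts t f" if t: "t \<in> set_pmf (edge_tester E r)" for t
    proof -
      obtain ps where "t = pair_test ps" "set ps \<subseteq> E\<^sup>+"
        using set_pmf_edge_tester[OF finE E(2) t] by metis
      then show ?thesis using \<open>graph_monotone V E f\<close> graph_monotone_iff_violations[OF E(1), of f]
        by (fastforce simp: accepts_pair_test violations_def not_less)
    qed
    then show "AE t in edge_tester E r. t \<in> {t. accepts t f}" by (auto simp: AE_measure_pmf_iff)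
  qed simp
  moreover have "measure_pmf.prob (edge_tester E r) {t. \<not> accepts t f} \<ge> 2 / 3"
    if far: "far_from_monotone V E \<epsilon> f" for f
  proof -
    let ?s = "sqrt (real (card E) * real (card (E\<^sup>+)))"
    let ?d = "\<epsilon> * real (card V)"
    define p where
      "p = measure_pmf.prob (mix_pmf (pmf_of_set E) (pmf_of_set (E\<^sup>+))) {p. f (snd p) < f (fst p)}"
    have "E\<^sup>+ \<noteq> {}" "finite (E\<^sup>+)" using finE E by auto
    then have s: "?s > 0" using finE E(2) by (simp add: card_gt_0_iff)
    have d: "?d > 0" using \<epsilon> V by simp
    have cancel: "2 = y / (3 * x) * (6 * x / y)" if "x > 0" "y > 0" for x y :: real
      using that by (simp add: field_simps)
    \<comment> \<open>A far \<open>f\<close> gives \<open>p\<close> at least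
      \<open>?d / (3 * ?s)\<close>, so the 6 in the bound on \<open>r\<close> makes
      \<open>p * real r\<close> at least 2.\<close>
    have "2 = ?d / (3 * ?s) * (6 * ?s / ?d)" using s d by (rule cancel)
    also have "\<dots> \<le> real (d_mon V E f) / (3 * ?s) * real r"
      using far s d r by (intro mult_mono divide_right_mono) (auto simp: far_from_monotone_def)
    also have "\<dots> \<le> p * real r"
      unfolding p_def by (intro mult_right_mono prob_sampled_violation_ge fin E) simp
    finally have "(1 - p) ^ r \<le> 1 / 3"
      by (intro one_minus_power_le_third) (auto simp: p_def)
    then show ?thesis unfolding prob_edge_tester_rejects p_def by simp
  qed
  ultimately show ?thesis by (auto simp: one_sided_monotonicity_tester_def)
qed

section \<open>Rounding the sample size and the final query bound\<close>

lemma far_from_monotone_imp_sqrt_ge: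
  assumes fin: "finite V" and E: "E \<subseteq> V \<times> V" and far: "far_from_monotone V E \<epsilon> f" and \<epsilon>: "\<epsilon> > 0"
  shows "E \<noteq> {}" "card V > 0"
    "\<epsilon> * real (card V) \<le> 3 * sqrt (real (card E) * real (card (E\<^sup>+)))"
proof -
  have d: "\<epsilon> * real (card V) < real (d_mon V E f)" using far by (simp add: far_from_monotone_def)
  moreover have "0 \<le> \<epsilon> * real (card V)" using \<epsilon> by simp
  ultimately have pos: "0 < d_mon V E f" by linarith
  show "E \<noteq> {}" using d_mon_squared_le_violations[OF fin E, of f] pos by (auto simp: violations_def)
  then show "card V > 0" using E fin by (auto simp: card_gt_0_iff)
  have finE: "finite E" using finite_subset[OF E] fin by simp
  then have "card E > 0" "card (E\<^sup>+) > 0" using \<open>E \<noteq> {}\<close> by (auto simp: card_gt_0_iff)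
  then have "0 < sqrt (real (card E) * real (card (E\<^sup>+)))" by simp
  \<comment> \<open>The quotient is a lower bound for a probability, hence at most 1; this bounds
    the distance of any \<open>f\<close> by \<open>3 * sqrt\<close> of the product.\<close>
  moreover have "real (d_mon V E f) / (3 * sqrt (real (card E) * real (card (E\<^sup>+)))) \<le> 1"
    using prob_sampled_violation_ge[OF fin E \<open>E \<noteq> {}\<close>, of f] measure_pmf.prob_le_1 by (rule order_trans)
  ultimately show "\<epsilon> * real (card V) \<le> 3 * sqrt (real (card E) * real (card (E\<^sup>+)))"
    using d by (simp add: field_simps)
qed

theorem theorem5p1:
  "\<exists>C::real. C > 0 \<and>
     (\<forall>(V :: 'v set) (E :: ('v \<times> 'v) set) (\<epsilon>::real).
        transitively_reduced V E \<and> \<epsilon> > 0 \<longrightarrow>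
        (\<exists>T. one_sided_monotonicity_tester V E \<epsilon> T \<and>
             query_complexity_le T
               (C * (sqrt (real (card E) * real (card (E\<^sup>+))) / (\<epsilon> * real (card V))))))"
proof (intro exI[of _ 18] conjI allI impI)
  fix V :: "'v set" and E :: "('v \<times> 'v) set" and \<epsilon> :: real
  assume "transitively_reduced V E \<and> \<epsilon> > 0"
  then have fin: "finite V" and E: "E \<subseteq> V \<times> V" and \<epsilon>: "\<epsilon> > 0"
    by (auto simp: transitively_reduced_def dag_def)
  have finE: "finite E" using finite_subset[OF E] fin by simp
  define s where "s = sqrt (real (card E) * real (card (E\<^sup>+)))"
  define d where "d = \<epsilon> * real (card V)"
  have "\<exists>T. one_sided_monotonicity_tester V E \<epsilon> T \<and> query_complexity_le T (18 * (s / d))"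
  proof (cases "\<exists>f. far_from_monotone V E \<epsilon> f")
    case False
    \<comment> \<open>With no far function, accepting without a query is correct. This covers an
      empty \<open>E\<close> or \<open>V\<close>, where the bound is 0, and large
      \<open>\<epsilon>\<close>, where it may be less than one query.\<close>
    have "0 \<le> s / d" using \<epsilon> by (simp add: s_def d_def)
    then have "one_sided_monotonicity_tester V E \<epsilon> (return_pmf (Verdict True)) \<and>
        query_complexity_le (return_pmf (Verdict True)) (18 * (s / d))"
      using False by (simp add: one_sided_monotonicity_tester_def query_complexity_le_def measure_return_pmf)
    then show ?thesis ..
  next
    case True
    then obtain f where "far_from_monotone V E \<epsilon> f" ..
    note far = far_from_monotone_imp_sqrt_ge[OF fin E this \<epsilon>]
    define r where "r = nat \<lceil>6 * s / d\<rceil>"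
    have d: "d > 0" using \<epsilon> far(2) by (simp add: d_def)
    have "0 \<le> 6 * s / d" using d by (simp add: s_def)
    then have "real r \<le> 6 * s / d + 1" unfolding r_def by linarith
    also have "\<dots> \<le> 9 * (s / d)" using far(3) d by (simp add: s_def d_def field_simps)
    \<comment> \<open>The rounding is absorbed because \<open>d \<le> 3 s\<close> as soon as some function is far.\<close>
    finally have r: "real r \<le> 9 * (s / d)" .
    have "one_sided_monotonicity_tester V E \<epsilon> (edge_tester E r)"
      using fin E far(1) \<epsilon> far(2)
      by (rule edge_tester_one_sided) (simp only: r_def s_def d_def real_nat_ceiling_ge)
    \<comment> \<open>The constant is 18 = 2 * 9: two queries for each of at most
      \<open>9 * (s / d)\<close> pairs, where 9 = 6 + 3 includes the rounding.\<close>
    moreover have "query_complexity_le (edge_tester E r) (18 * (s / d))"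
      unfolding query_complexity_le_def
    proof (intro ballI allI)
      fix t f assume "t \<in> set_pmf (edge_tester E r)"
      then obtain ps where "t = pair_test ps" "length ps = r"
        using set_pmf_edge_tester[OF finE far(1)] by metis
      then have "real (length (queries t f)) \<le> 2 * real r"
        using length_queries_pair_test[of ps f] by simp
      also have "\<dots> \<le> 18 * (s / d)" using r by simp
      finally show "real (length (queries t f)) \<le> 18 * (s / d)" .
    qed
    ultimately show ?thesis by blast
  qed
  then show "\<exists>T. one_sided_monotonicity_tester V E \<epsilon> T \<and>
      query_complexity_le T (18 * (sqrt (real (card E) * real (card (E\<^sup>+))) / (\<epsilon> * real (card V))))"
    by (simp only: s_def d_def)
qed simp

end
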